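(* Let $R$ be an integral domain with quotient field $K$. Then $R$ is a G-Dedekind domain (also called a Pseudo Dedekind domain) if and only if for each nonzero ideal $A$ of $R$ and for each allowable set $\{a_\alpha\}_{\alpha\in I}\subseteq K\setminus\{0\}$ we have $A_v\left(\bigcap_{\alpha\in I}(a_\alpha)\right)=\bigcap_{\alpha\in I}A_v(a_\alpha)$.
   Context: $F(R)$ denotes the set of nonzero fractional ideals of $R$, and $(a)=aR$ for $a\in K$. For $A\in F(R)$, $A^{-1}=\{x\in K: xA\subseteq R\}$ and $A_v=(A^{-1})^{-1}$. $R$ is a G-Dedekind (equivalently, Pseudo Dedekind) domain if $A_v$ is invertible for every nonzero ideal $A$ of $R$ (equivalently for every $A\in F(R)$). A (nonempty) set $\{a_\alpha\}_{\alpha\in I}\subseteq K\setminus\{0\}$ is called allowable if $\bigcap_{\alpha\in I}(a_\alpha)\neq(0)$. *)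

theory Defs
  imports "HOL-Computational_Algebra.Polynomial_Factorial"
begin

text \<open>
  The integral domain \<open>R\<close> is (the universe of) a type \<open>'a\<close> of class \<^class>\<open>idom\<close>, and its
  quotient field \<open>K\<close> is the library type \<open>'a fract\<close>, with embedding \<^const>\<open>to_fract\<close>.
  Ideals of \<open>R\<close> are sets of type \<open>'a set\<close>; fractional ideals are sets of type \<open>'a fract set\<close>.
\<close>

definition is_ideal :: "'a::idom set \<Rightarrow> bool" where
  "is_ideal A \<longleftrightarrow> module.subspace (*) A"

definition fscale :: "'a::idom \<Rightarrow> 'a fract \<Rightarrow> 'a fract" where
  "fscale r x = to_fract r * x"

lemma module_self: "module ((*) :: 'a::idom \<Rightarrow> 'a \<Rightarrow> 'a)"
  by unfold_locales (simp_all add: algebra_simps)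

lemma module_fscale: "module (fscale :: 'a::idom \<Rightarrow> 'a fract \<Rightarrow> 'a fract)"
  by unfold_locales (simp_all add: fscale_def algebra_simps)

definition frac_ideals :: "'a::idom fract set set" where
  "frac_ideals = {J. module.subspace fscale J \<and> J \<noteq> {0} \<and>
     (\<exists>d. d \<noteq> 0 \<and> (\<forall>x\<in>J. fscale d x \<in> range to_fract))}"

definition princ :: "'a::idom fract \<Rightarrow> 'a fract set" where
  "princ a = {a * to_fract r | r. True}"

text \<open>The product of two \<open>R\<close>-submodules of \<open>K\<close> consists of the finite sums of elementwise
  products; these already form the \<open>R\<close>-span.\<close>

definition fprod :: "'a::idom fract set \<Rightarrow> 'a fract set \<Rightarrow> 'a fract set"
    (infixl \<open>\<cdot>\<^sub>F\<close> 70) where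
  "A \<cdot>\<^sub>F B = module.span fscale {a * b | a b. a \<in> A \<and> b \<in> B}"

definition finv :: "'a::idom fract set \<Rightarrow> 'a fract set" where
  "finv A = {x. \<forall>a\<in>A. x * a \<in> range to_fract}"

definition v_closure :: "'a::idom fract set \<Rightarrow> 'a fract set" where
  "v_closure A = finv (finv A)"

definition invertible_frac :: "'a::idom fract set \<Rightarrow> bool" where
  "invertible_frac A \<longleftrightarrow> A \<in> frac_ideals \<and> (\<exists>B\<in>frac_ideals. A \<cdot>\<^sub>F B = range to_fract)"

text \<open>The argument of type \<open>'a itself\<close> only serves to name the domain.\<close>

definition G_Dedekind :: "'a::idom itself \<Rightarrow> bool" where
  "G_Dedekind _ \<longleftrightarrow>
     (\<forall>A :: 'a set. is_ideal A \<and> A \<noteq> {0} \<longrightarrow> invertible_frac (v_closure (to_fract ` A)))"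

definition allowable :: "'a::idom fract set \<Rightarrow> bool" where
  "allowable S \<longleftrightarrow> S \<noteq> {} \<and> 0 \<notin> S \<and> (\<Inter>a\<in>S. princ a) \<noteq> {0}"

end

theory Submission
  imports Defs
begin

text \<open>
  If \<open>A\<^sub>v B = R\<close>, write \<open>1 = \<Sum> v\<^sub>i b\<^sub>i\<close>; an element \<open>x\<close> of \<open>\<Inter> A\<^sub>v (a)\<close> satisfies
  \<open>b\<^sub>i x \<in> \<Inter> (a)\<close>, so \<open>x = \<Sum> v\<^sub>i (b\<^sub>i x)\<close> lies in \<open>A\<^sub>v (\<Inter> (a))\<close>.
  Conversely, \<open>A\<^sup>-\<^sup>1\<close> is the intersection of the principal ideals \<open>(1/a)\<close> over nonzero \<open>a \<in> A\<close>, so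
  the identity gives \<open>A\<^sub>v A\<^sup>-\<^sup>1 = \<Inter> A\<^sub>v (1/a)\<close>, and the right-hand side contains \<open>1\<close>
  because \<open>a \<in> A\<^sub>v\<close>.
\<close>

interpretation fr: module "fscale :: 'a::idom \<Rightarrow> 'a fract \<Rightarrow> 'a fract"
  by (rule module_fscale)

lemma range_to_fract_closed:
  shows "0 \<in> range to_fract"
    and "x \<in> range to_fract \<Longrightarrow> y \<in> range to_fract \<Longrightarrow> x + y \<in> range to_fract"
    and "x \<in> range to_fract \<Longrightarrow> y \<in> range to_fract \<Longrightarrow> x * y \<in> range to_fract"
  by (metis rangeI to_fract_0) (auto simp flip: to_fract_add to_fract_mult)

lemma subspace_range_to_fract: "fr.subspace (range to_fract)"
  unfolding fr.subspace_def fscale_def by (auto intro!: range_to_fract_closed)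

lemma subspace_princ: "fr.subspace (princ a)"
proof (rule fr.subspaceI)
  show "0 \<in> princ a" unfolding princ_def by (auto intro!: exI[of _ 0])
next
  fix x y assume "x \<in> princ a" "y \<in> princ a"
  then obtain r s where "x = a * to_fract r" "y = a * to_fract s"
    unfolding princ_def by blast
  then have "x + y = a * to_fract (r + s)" by (simp add: algebra_simps)
  then show "x + y \<in> princ a" unfolding princ_def by blast
next
  fix c x assume "x \<in> princ a"
  then obtain r where "x = a * to_fract r" unfolding princ_def by blast
  then have "fscale c x = a * to_fract (c * r)" by (simp add: fscale_def)
  then show "fscale c x \<in> princ a" unfolding princ_def by blast
qed

lemma subspace_finv: "fr.subspace (finv A)"
  unfolding finv_def fr.subspace_def fscale_def
  by (simp add: distrib_right mult.assoc range_to_fract_closed)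

lemma subspace_fprod: "fr.subspace (A \<cdot>\<^sub>F B)"
  unfolding fprod_def by (rule fr.subspace_span)

lemma fprod_memI: "a \<in> A \<Longrightarrow> b \<in> B \<Longrightarrow> a * b \<in> A \<cdot>\<^sub>F B"
  unfolding fprod_def by (rule fr.span_base) blast

lemma fprod_subsetI:
  assumes "fr.subspace C" and "\<And>a b. a \<in> A \<Longrightarrow> b \<in> B \<Longrightarrow> a * b \<in> C"
  shows "A \<cdot>\<^sub>F B \<subseteq> C"
  unfolding fprod_def by (rule fr.span_minimal) (use assms in auto)

lemma fprod_mono: "B \<subseteq> C \<Longrightarrow> A \<cdot>\<^sub>F B \<subseteq> A \<cdot>\<^sub>F C"
  by (rule fprod_subsetI[OF subspace_fprod]) (auto intro: fprod_memI)

text \<open>Paired with \<open>fprod_subsetI\<close>, this reduces a claim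
  \<open>y * x \<in> C\<close> for all \<open>y\<close> in a product to the generators
  \<open>a * b\<close>, so finite sums never have to be written out.\<close>

lemma subspace_vimage_mult:
  assumes "fr.subspace C"
  shows "fr.subspace {y. y * x \<in> C}"
  using assms unfolding fr.subspace_def fscale_def by (auto simp: distrib_right mult.assoc)

lemma subset_v_closure: "A \<subseteq> v_closure A"
  unfolding v_closure_def finv_def by (auto simp: mult.commute)

lemma v_closure_mult_finv:
  "v \<in> v_closure A \<Longrightarrow> y \<in> finv A \<Longrightarrow> v * y \<in> range to_fract"
  unfolding v_closure_def finv_def by blast

lemma finv_eq_Inter_princ:
  "finv A = (\<Inter>a\<in>inverse ` (A - {0}). princ a)"
proof -
  have nonzero: "x * a \<in> range to_fract \<longleftrightarrow> x \<in> princ (inverse a)" if "a \<noteq> 0"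
    for x a :: "'a fract"
    using that unfolding princ_def by (auto simp: field_simps)
  have "finv A = {x. \<forall>a\<in>A - {0}. x * a \<in> range to_fract}"
    unfolding finv_def using range_to_fract_closed(1) by force
  also have "\<dots> = {x. \<forall>a\<in>A - {0}. x \<in> princ (inverse a)}"
    by (simp add: nonzero)
  finally show ?thesis by auto
qed

lemma fprod_Inter_princ_of_invertible:
  assumes "V \<cdot>\<^sub>F B = range to_fract"
  shows "V \<cdot>\<^sub>F (\<Inter>a\<in>S. princ a) = (\<Inter>a\<in>S. V \<cdot>\<^sub>F princ a)"
proof (intro subset_antisym subsetI)
  fix x assume "x \<in> V \<cdot>\<^sub>F (\<Inter>a\<in>S. princ a)"
  then show "x \<in> (\<Inter>a\<in>S. V \<cdot>\<^sub>F princ a)"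
    using fprod_mono[OF INF_lower] by fast
next
  fix x assume x: "x \<in> (\<Inter>a\<in>S. V \<cdot>\<^sub>F princ a)"
  let ?I = "\<Inter>a\<in>S. princ a"
  have bx: "x * b \<in> ?I" if "b \<in> B" for b
  proof
    fix a assume "a \<in> S"
    \<comment> \<open>On a generator \<open>v * c\<close>, the factor \<open>v * b\<close> lies in
      \<open>R\<close>, so \<open>v * c * b\<close> is an \<open>R\<close>-multiple of
      \<open>c\<close> and stays in \<open>princ a\<close>.\<close>
    have "V \<cdot>\<^sub>F princ a \<subseteq> {y. y * b \<in> princ a}"
    proof (rule fprod_subsetI[OF subspace_vimage_mult[OF subspace_princ]])
      fix v c assume "v \<in> V" "c \<in> princ a"
      obtain r where "v * b = to_fract r"
        using assms fprod_memI[OF \<open>v \<in> V\<close> \<open>b \<in> B\<close>] by blast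
      then have "v * c * b = fscale r c" by (metis fscale_def mult.assoc mult.commute)
      then show "v * c \<in> {y. y * b \<in> princ a}"
        using fr.subspace_scale[OF subspace_princ \<open>c \<in> princ a\<close>] by simp
    qed
    then show "x * b \<in> princ a" using x \<open>a \<in> S\<close> by blast
  qed
  \<comment> \<open>This submodule absorbs the expansion of \<open>1\<close> as a sum of products:
    it contains every \<open>v * b\<close>, hence all of \<open>V \<cdot>\<^sub>F B\<close>, and
    membership of \<open>1\<close> is the claim for \<open>x\<close>.\<close>
  have "V \<cdot>\<^sub>F B \<subseteq> {y. y * x \<in> V \<cdot>\<^sub>F ?I}"
  proof (rule fprod_subsetI[OF subspace_vimage_mult[OF subspace_fprod]])
    fix v b assume "v \<in> V" "b \<in> B"
    then have "v * (x * b) \<in> V \<cdot>\<^sub>F ?I" by (intro fprod_memI bx)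
    then show "v * b \<in> {y. y * x \<in> V \<cdot>\<^sub>F ?I}" by (simp add: mult_ac)
  qed
  moreover have "1 \<in> V \<cdot>\<^sub>F B" unfolding assms by (metis rangeI to_fract_1)
  ultimately show "x \<in> V \<cdot>\<^sub>F ?I" by auto
qed

lemma subspace_eq_range_to_fract:
  assumes "fr.subspace C" "C \<subseteq> range to_fract" "1 \<in> C"
  shows "C = range to_fract"
proof -
  have "to_fract r \<in> C" for r
    using fr.subspace_scale[OF assms(1,3), of r] by (simp add: fscale_def)
  then show ?thesis using assms(2) by blast
qed

lemma invertible_v_closure:
  assumes "is_ideal (A :: 'a::idom set)" "A \<noteq> {0}"
    and distrib: "\<And>S :: 'a fract set. allowable S \<Longrightarrow>
      v_closure (to_fract ` A) \<cdot>\<^sub>F (\<Inter>a\<in>S. princ a) = (\<Inter>a\<in>S. v_closure (to_fract ` A) \<cdot>\<^sub>F princ a)"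
  shows "invertible_frac (v_closure (to_fract ` A))"
proof -
  let ?A = "to_fract ` A" and ?V = "v_closure (to_fract ` A)" and ?I = "finv (to_fract ` A)"
  \<comment> \<open>Chosen so that the intersection of its principal ideals is \<open>?I\<close>,
    the candidate inverse of \<open>?V\<close>.\<close>
  let ?S = "inverse ` (?A - {0})"
  have "0 \<in> A"
    using assms(1) module.subspace_0[OF module_self] unfolding is_ideal_def by blast
  with assms(2) obtain a where a: "a \<in> A" "a \<noteq> 0" by blast
  \<comment> \<open>Since \<open>A\<close> lies in \<open>R\<close>. This fact gives
    \<open>?V \<subseteq> R\<close>, makes \<open>?I\<close> nonzero, and later makes
    \<open>?S\<close> allowable.\<close>
  have one: "1 \<in> ?I" unfolding finv_def by auto
  have V_sub: "?V \<subseteq> range to_fract" using v_closure_mult_finv[OF _ one] by auto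
  have aV: "to_fract a \<in> ?V" using a subset_v_closure by blast
  have V_frac: "?V \<in> frac_ideals"
    unfolding frac_ideals_def
  proof (intro CollectI conjI exI[of _ 1] ballI)
    show "fr.subspace ?V" unfolding v_closure_def by (rule subspace_finv)
    show "?V \<noteq> {0}" using aV a(2) by auto
    show "fscale 1 x \<in> range to_fract" if "x \<in> ?V" for x
      using that V_sub by (auto simp: fscale_def)
  qed simp
  have I_frac: "?I \<in> frac_ideals"
    unfolding frac_ideals_def
  \<comment> \<open>Any nonzero \<open>a\<close> of \<open>A\<close> is a common denominator of
    \<open>?I\<close>, by the very definition of \<open>finv\<close>.\<close>
  proof (intro CollectI conjI exI[of _ a] ballI)
    show "fr.subspace ?I" by (rule subspace_finv)
    show "?I \<noteq> {0}" using one by auto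
    show "fscale a x \<in> range to_fract" if "x \<in> ?I" for x
      using that a(1) unfolding finv_def fscale_def by (auto simp: mult.commute)
  qed (fact a(2))
  have "allowable ?S"
    unfolding allowable_def finv_eq_Inter_princ[symmetric] using one a by auto
  then have eq: "?V \<cdot>\<^sub>F ?I = (\<Inter>b\<in>?S. ?V \<cdot>\<^sub>F princ b)"
    unfolding finv_eq_Inter_princ by (rule distrib)
  \<comment> \<open>The generator \<open>1/b\<close> of the principal ideal is cancelled by
    \<open>b\<close> itself, which is available in \<open>?V\<close> because
    \<open>A \<subseteq> A_v\<close>.\<close>
  have "1 \<in> ?V \<cdot>\<^sub>F princ (inverse b)" if b: "b \<in> ?A - {0}" for b
  proof -
    have "inverse b \<in> princ (inverse b)" unfolding princ_def by (auto intro!: exI[of _ 1])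
    moreover have "b \<in> ?V" using b subset_v_closure by blast
    ultimately have "b * inverse b \<in> ?V \<cdot>\<^sub>F princ (inverse b)" by (intro fprod_memI)
    then show ?thesis using b by simp
  qed
  then have "1 \<in> ?V \<cdot>\<^sub>F ?I" unfolding eq by blast
  moreover have "?V \<cdot>\<^sub>F ?I \<subseteq> range to_fract"
    by (intro fprod_subsetI subspace_range_to_fract v_closure_mult_finv)
  ultimately have "?V \<cdot>\<^sub>F ?I = range to_fract"
    by (intro subspace_eq_range_to_fract subspace_fprod)
  with V_frac I_frac show ?thesis unfolding invertible_frac_def by blast
qed

theorem corollary3:
  shows "G_Dedekind TYPE('a::idom) \<longleftrightarrow>
    (\<forall>A :: 'a set. is_ideal A \<and> A \<noteq> {0} \<longrightarrow>
      (\<forall>S :: 'a fract set. allowable S \<longrightarrow>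
        v_closure (to_fract ` A) \<cdot>\<^sub>F (\<Inter>a\<in>S. princ a) =
          (\<Inter>a\<in>S. v_closure (to_fract ` A) \<cdot>\<^sub>F princ a)))"
  (is "_ \<longleftrightarrow> ?rhs")
proof
  assume "G_Dedekind TYPE('a)"
  then show ?rhs
    unfolding G_Dedekind_def invertible_frac_def
    using fprod_Inter_princ_of_invertible by metis
next
  assume ?rhs
  then show "G_Dedekind TYPE('a)"
    unfolding G_Dedekind_def by (blast intro: invertible_v_closure)
qed

end
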